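(* Let $d_G=\dim V_G$ and let $p\ge 2\dim(\mathcal V)-d_G$ be an integer. Then for a generic $\mathbf w=(w_1,\dots,w_p)\in\mathcal V^p$ with respect to the Zariski topology the following holds: for every $S\subset[N]\times[p]$ such that $S_i\ne\emptyset$ for all $i\in[p]$, the map $\hat\Phi_{\mathbf w,S}:\hat{\mathcal V}\to\mathbb R^{|S|}$ is injective.
   Context: $(\mathcal V,\langle\cdot,\cdot\rangle)$ is a real inner product space of finite dimension $d\ge 2$, and $G$ is a finite group of order $|G|=N$ acting unitarily on $\mathcal V$: each $g\in G$ acts by a linear isometry $U_g$ of $\mathcal V$. Write $x\sim y$ if $y=U_gx$ for some $g\in G$, $[x]=\{U_gx:g\in G\}$, and $\hat{\mathcal V}=\mathcal V/\sim$. Write $[r]=\{1,\dots,r\}$. $V_G=\{x\in\mathcal V:U_gx=x\ \forall g\in G\}$. For $w,x\in\mathcal V$ and $j\in[N]$, $\Phi_{w,j}(x)$ is the $j$-th entry of the vector obtained by sorting the $N$ numbers $(\langle U_gw,x\rangle)_{g\in G}$ (with repetitions) in decreasing order. For $\mathbf w=(w_1,\dots,w_p)\in\mathcal V^p$ and $S\subset[N]\times[p]$, let $S_i=\{k\in[N]:(k,i)\in S\}$ for $i\in[p]$, and $$\Phi_{\mathbf w,S}:\mathcal V\to\mathbb R^{|S|},\qquad \Phi_{\mathbf w,S}(x)=\big[\{\Phi_{w_1,j}(x)\}_{j\in S_1},\dots,\{\Phi_{w_p,j}(x)\}_{j\in S_p}\big].$$ This map is $G$-invariant and so induces $\hat\Phi_{\mathbf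 w,S}:\hat{\mathcal V}\to\mathbb R^{|S|}$, $\hat\Phi_{\mathbf w,S}([x])=\Phi_{\mathbf w,S}(x)$. A property holds for generic $\mathbf w\in\mathcal V^p$ with respect to the Zariski topology if it holds for all $\mathbf w$ in some nonempty Zariski-open subset of $\mathcal V^p\cong\mathbb R^{dp}$. *)

theory Defs
  imports "HOL-Analysis.Analysis" "HOL-Algebra.Group_Action"
begin

section \<open>Zariski topology and generic points\<close>

text \<open>The coordinate-free polynomials \<^const>\<open>real_polynomial_function\<close> on a Euclidean space of
  dimension \<open>n\<close> are the polynomials in its \<open>n\<close> coordinates, so the complements of their common zero
  sets are the Zariski-open sets.\<close>

definition zariski_topology :: "'a::euclidean_space topology" where
  "zariski_topology = topology (\<lambda>W.
     \<exists>F. F \<subseteq> Collect real_polynomial_function \<and> W = - {x. \<forall>f\<in>F. f x = 0})"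

lemma openin_zariski_topology:
  "openin zariski_topology W \<longleftrightarrow>
     (\<exists>F. F \<subseteq> Collect real_polynomial_function \<and> W = - {x::'a::euclidean_space. \<forall>f\<in>F. f x = 0})"
proof -
  define op where "op W \<longleftrightarrow>
    (\<exists>F. F \<subseteq> Collect real_polynomial_function \<and> W = - {x::'a. \<forall>f\<in>F. f x = 0})" for W
  have op_iff: "op W \<longleftrightarrow>
    (\<exists>F\<subseteq>Collect real_polynomial_function. \<forall>x. x \<in> W \<longleftrightarrow> (\<exists>f\<in>F. f x \<noteq> 0))" for W
    unfolding op_def set_eq_iff by simp
  have "op (S \<inter> T)" if "op S" "op T" for S T
  proof -
    from that obtain A B where A: "A \<subseteq> Collect real_polynomial_function"
      and SA: "\<And>x. x \<in> S \<longleftrightarrow> (\<exists>f\<in>A. f x \<noteq> 0)"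
      and B: "B \<subseteq> Collect real_polynomial_function"
      and TB: "\<And>x. x \<in> T \<longleftrightarrow> (\<exists>f\<in>B. f x \<noteq> 0)"
      unfolding op_iff by (elim exE conjE) blast
    show ?thesis
      unfolding op_iff
    proof (intro exI conjI allI)
      show "(\<Union>f\<in>A. \<Union>g\<in>B. {\<lambda>x. f x * g x}) \<subseteq> Collect real_polynomial_function"
        using A B by (auto intro!: real_polynomial_function.intros(4))
      show "x \<in> S \<inter> T \<longleftrightarrow> (\<exists>h\<in>(\<Union>f\<in>A. \<Union>g\<in>B. {\<lambda>x. f x * g x}). h x \<noteq> 0)" for x
        by (simp add: SA TB)
    qed
  qed
  moreover have "op (\<Union>K)" if "\<forall>W\<in>K. op W" for K
  proof -
    from that have "\<forall>W\<in>K. \<exists>F. F \<subseteq> Collect real_polynomial_function \<and>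
        (\<forall>x. x \<in> W \<longleftrightarrow> (\<exists>f\<in>F. f x \<noteq> 0))"
      unfolding op_iff .
    from bchoice[OF this] obtain F where
      "\<forall>W\<in>K. F W \<subseteq> Collect real_polynomial_function \<and>
        (\<forall>x. x \<in> W \<longleftrightarrow> (\<exists>f\<in>F W. f x \<noteq> 0))" ..
    then have F: "\<And>W. W \<in> K \<Longrightarrow> F W \<subseteq> Collect real_polynomial_function"
      and iff: "\<And>W x. W \<in> K \<Longrightarrow> x \<in> W \<longleftrightarrow> (\<exists>f\<in>F W. f x \<noteq> 0)"
      by simp_all
    show ?thesis
      unfolding op_iff
    proof (intro exI conjI allI)
      show "(\<Union>W\<in>K. F W) \<subseteq> Collect real_polynomial_function"
        using F by blast
      show "x \<in> \<Union>K \<longleftrightarrow> (\<exists>f\<in>(\<Union>W\<in>K. F W). f x \<noteq> 0)" for x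
        by (simp add: iff cong: bex_cong)
    qed
  qed
  ultimately have "istopology op"
    unfolding istopology_def by simp
  then show ?thesis
    unfolding zariski_topology_def op_def[abs_def] by (simp only: topology_inverse')
qed

definition zariski_generic :: "('a::euclidean_space \<Rightarrow> bool) \<Rightarrow> bool" where
  "zariski_generic P \<longleftrightarrow> (\<exists>W. openin zariski_topology W \<and> W \<noteq> {} \<and> (\<forall>w\<in>W. P w))"

section \<open>Sorted coorbits\<close>

definition fixed_subspace :: "('g, 'm) monoid_scheme \<Rightarrow> ('g \<Rightarrow> 'v \<Rightarrow> 'v) \<Rightarrow> 'v set" where
  "fixed_subspace G U = (\<Inter>g\<in>carrier G. invariants UNIV U g)"

text \<open>Positions in the sorted list are counted from \<open>1\<close>, so \<open>j\<close> ranges over \<open>{1..order G}\<close>.\<close>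

definition coorbit ::
  "('g, 'm) monoid_scheme \<Rightarrow> ('g \<Rightarrow> 'v::euclidean_space \<Rightarrow> 'v) \<Rightarrow> 'v \<Rightarrow> nat \<Rightarrow> 'v \<Rightarrow> real" where
  "coorbit G U w j x =
     rev (sorted_list_of_multiset {#U g w \<bullet> x. g \<in># mset_set (carrier G)#}) ! (j - 1)"

text \<open>A tuple of \<open>p\<close> vectors is an element of \<open>'v ^ 'p\<close> with \<open>CARD('p) = p\<close>, and \<open>\<real>\<^bsup>|S|\<^esup>\<close> is
  the space of real functions on \<open>S\<close>, extended by \<open>undefined\<close> outside \<open>S\<close>.\<close>

definition coorbit_map ::
  "('g, 'm) monoid_scheme \<Rightarrow> ('g \<Rightarrow> 'v::euclidean_space \<Rightarrow> 'v) \<Rightarrow> 'v ^ 'p \<Rightarrow> (nat \<times> 'p) set \<Rightarrow>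
     'v \<Rightarrow> nat \<times> 'p \<Rightarrow> real" where
  "coorbit_map G U w S x = (\<lambda>(j, i)\<in>S. coorbit G U (w $ i) j x)"

text \<open>\<open>coorbit_map\<close> is constant on each orbit, so its value on an orbit is the unique element of
  the image; see \<open>coorbit_map_quot_orbit\<close> below.\<close>

definition coorbit_map_quot ::
  "('g, 'm) monoid_scheme \<Rightarrow> ('g \<Rightarrow> 'v::euclidean_space \<Rightarrow> 'v) \<Rightarrow> 'v ^ 'p \<Rightarrow> (nat \<times> 'p) set \<Rightarrow>
     'v set \<Rightarrow> nat \<times> 'p \<Rightarrow> real" where
  "coorbit_map_quot G U w S c = the_elem (coorbit_map G U w S ` c)"

lemma coorbit_invariant:
  assumes act: "group_action G UNIV U"
    and iso: "\<And>g. g \<in> carrier G \<Longrightarrow> orthogonal_transformation (U g)"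
    and h: "h \<in> carrier G"
  shows "coorbit G U w j (U h x) = coorbit G U w j x"
proof -
  interpret group_action G UNIV U by fact
  interpret group G using group_hom by (simp add: group_hom_def)
  have "image_mset ((\<otimes>\<^bsub>G\<^esub>) h) (mset_set (carrier G)) = mset_set (carrier G)"
    using image_mset_mset_set[OF inj_on_cmult[OF h]] surj_const_mult[OF h] by simp
  then have "{#U g w \<bullet> U h x. g \<in># mset_set (carrier G)#} =
      {#U g w \<bullet> U h x. g \<in># image_mset ((\<otimes>\<^bsub>G\<^esub>) h) (mset_set (carrier G))#}"
    by (simp only:)
  also have "\<dots> = {#U g w \<bullet> x. g \<in># mset_set (carrier G)#}"
    unfolding multiset.map_comp
  proof (rule image_mset_cong)
    fix g assume "g \<in># mset_set (carrier G)"
    then have g: "g \<in> carrier G"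
      by (metis elem_mset_set empty_iff mset_set.infinite set_mset_empty)
    have "U (h \<otimes>\<^bsub>G\<^esub> g) w \<bullet> U h x = U h (U g w) \<bullet> U h x"
      using composition_rule[OF _ h g] by simp
    also have "\<dots> = U g w \<bullet> x"
      using iso[OF h] by (simp add: orthogonal_transformation_def)
    finally show "((\<lambda>g. U g w \<bullet> U h x) \<circ> (\<otimes>\<^bsub>G\<^esub>) h) g = U g w \<bullet> x"
      by simp
  qed
  finally show ?thesis
    unfolding coorbit_def by simp
qed

lemma coorbit_map_quot_orbit:
  assumes act: "group_action G UNIV U"
    and iso: "\<And>g. g \<in> carrier G \<Longrightarrow> orthogonal_transformation (U g)"
  shows "coorbit_map_quot G U w S (orbit G U x) = coorbit_map G U w S x"
proof -
  interpret group_action G UNIV U by fact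
  interpret group G using group_hom by (simp add: group_hom_def)
  have "coorbit_map G U w S (U h x) = coorbit_map G U w S x" if "h \<in> carrier G" for h
    unfolding coorbit_map_def using coorbit_invariant[OF act iso that] by simp
  then have "coorbit_map G U w S ` orbit G U x \<subseteq> {coorbit_map G U w S x}"
    unfolding orbit_def by blast
  moreover have "orbit G U x \<noteq> {}"
    unfolding orbit_def using one_closed by blast
  ultimately have "coorbit_map G U w S ` orbit G U x = {coorbit_map G U w S x}"
    by (metis image_is_empty subset_singletonD)
  then show ?thesis
    unfolding coorbit_map_quot_def by simp
qed

end

theory Submission
  imports Defs
begin

text \<open>
Every sorted coorbit value is one of the numbers \<open>U g w \<bullet> x\<close>. So if \<open>x\<close> and \<open>y\<close> have the same image,
then for each \<open>i\<close> there is a pair \<open>(g, h)\<close> in \<open>G \<times> G\<close> with \<open>U g (w $ i) \<bullet> x = U h (w $ i) \<bullet> y\<close>; that is,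
the vector \<open>(U g (w $ i), - U h (w $ i))\<close> is orthogonal to \<open>(x, y)\<close> in \<open>V \<times> V\<close>. There are only
finitely many ways \<open>c\<close> to assign such a pair to each \<open>i\<close>, and a product of nonzero polynomials is
nonzero (\<open>real_polynomial_function_prod_nonzero\<close>), so it suffices to find, for each fixed \<open>c\<close>, one
nonzero polynomial in \<open>w\<close> whose nonvanishing forces such \<open>x\<close> and \<open>y\<close> to lie in the same orbit.

Fix \<open>c\<close> and write \<open>L i v = (U g v, - U h v)\<close>, where \<open>(g, h) = c i\<close>. Choose a maximal set \<open>J\<close> of indices
for which some tuple \<open>w\<close> makes the vectors \<open>L i (w $ i)\<close> with \<open>i \<in> J\<close> linearly independent. Their Gram
determinant is the polynomial. Suppose that it does not vanish at \<open>w\<close> and that every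
\<open>L i (w $ i)\<close> is orthogonal to \<open>(x, y)\<close>.

\<^item> If some \<open>k\<close> lies outside \<open>J\<close>, then by maximality \<open>L k v\<close> lies, for every \<open>v\<close>, in the span of the
  vectors with index in \<open>J\<close>: otherwise \<open>v\<close> as \<open>k\<close>-th entry would enlarge \<open>J\<close>. Hence the
  whole range of \<open>L k\<close> is orthogonal to \<open>(x, y)\<close> (\<open>generic_annihilator\<close>), which says that an element of the orbit of \<open>x\<close> equals one
  of the orbit of \<open>y\<close> (\<open>orthogonal_to_orbit_pair\<close>).
\<^item> If \<open>J\<close> contains all \<open>p\<close> indices, then there are \<open>p \<ge> 2 d - d\<^sub>G\<close> independent vectors orthogonal both to
  \<open>(x, y)\<close> and to the diagonal copy of \<open>V\<^sub>G\<close>, which has dimension \<open>d\<^sub>G\<close>. In the \<open>2 d\<close>-dimensional space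
  \<open>V \<times> V\<close> this leaves no room for \<open>(x, y)\<close> outside the diagonal, so \<open>x = y\<close>
  (\<open>diagonal_of_orthogonal_independent\<close>).

Working with a maximal independent set in this way replaces a count of dimensions of semialgebraic
sets by linear algebra.
\<close>

section \<open>Nonvanishing of real polynomials\<close>

text \<open>On the line through \<open>a\<close> and \<open>b\<close>, both restrict to nonzero
  polynomials in one variable, and these have only finitely many roots altogether.\<close>

lemma real_polynomial_function_mult_nonzero:
  fixes f g :: "'a::euclidean_space \<Rightarrow> real"
  assumes f: "real_polynomial_function f" and g: "real_polynomial_function g"
    and "f a \<noteq> 0" "g b \<noteq> 0"
  shows "\<exists>x. f x * g x \<noteq> 0"
proof -
  define line where "line t = a + t *\<^sub>R (b - a)" for t :: real
  have fin: "finite {t. h (line t) = 0}"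
    if h: "real_polynomial_function h" and t: "h (line t) \<noteq> 0" for h t
  proof -
    have "polynomial_function line"
      unfolding line_def
      by (intro polynomial_function_add polynomial_function_const
          polynomial_function_bounded_linear bounded_linear_scaleR_left)
    then have "real_polynomial_function (h \<circ> line)"
      using h by (rule real_polynomial_function_compose)
    then obtain c n where c: "h \<circ> line = (\<lambda>t. \<Sum>i\<le>n. c i * t ^ i)"
      using real_polynomial_function_iff_sum by blast
    have "\<exists>i\<le>n. c i \<noteq> 0"
    proof (rule ccontr)
      assume "\<not> ?thesis"
      then have "(\<Sum>i\<le>n. c i * t ^ i) = 0" by simp
      then show False using t fun_cong[OF c, of t] by simp
    qed
    then show ?thesis
      using polyfun_finite_roots[of c n] fun_cong[OF c] by simp
  qed
  have "finite ({t. f (line t) = 0} \<union> {t. g (line t) = 0})"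
    using fin[OF f, of 0] fin[OF g, of 1] assms by (simp add: line_def)
  then obtain t where "t \<notin> {t. f (line t) = 0} \<union> {t. g (line t) = 0}"
    using ex_new_if_finite infinite_UNIV_char_0 by blast
  then show ?thesis by (intro exI[of _ "line t"]) simp
qed

lemma real_polynomial_function_prod_nonzero:
  fixes f :: "'i \<Rightarrow> 'a::euclidean_space \<Rightarrow> real"
  assumes "finite I" and "\<And>i. i \<in> I \<Longrightarrow> real_polynomial_function (f i)"
    and "\<And>i. i \<in> I \<Longrightarrow> \<exists>x. f i x \<noteq> 0"
  shows "\<exists>x. (\<Prod>i\<in>I. f i x) \<noteq> 0"
  using assms
proof (induction I rule: finite_induct)
  case (insert i I)
  then obtain a b where "f i a \<noteq> 0" "(\<Prod>i\<in>I. f i b) \<noteq> 0"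
    by blast
  moreover have "real_polynomial_function (\<lambda>x. \<Prod>i\<in>I. f i x)"
    using insert by auto
  ultimately show ?case
    using real_polynomial_function_mult_nonzero[of "f i" "\<lambda>x. \<Prod>i\<in>I. f i x"] insert.hyps insert.prems(1)
    by simp
qed simp

lemma zariski_generic_nonvanishing:
  assumes "real_polynomial_function f" "f a \<noteq> 0" "\<And>w. f w \<noteq> 0 \<Longrightarrow> P w"
  shows "zariski_generic P"
proof -
  have "openin zariski_topology (- {x. \<forall>h\<in>{f}. h x = 0})"
    unfolding openin_zariski_topology using assms(1) by blast
  then show ?thesis
    unfolding zariski_generic_def using assms(2,3)
    by (intro exI[of _ "- {x. \<forall>h\<in>{f}. h x = 0}"]) auto
qed

section \<open>Gram determinants\<close>

text \<open>The Gram matrix of the vectors with index in \<open>J\<close>, padded with an identity block. The padding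
  keeps the index type the same for all \<open>J\<close> and leaves the determinant unchanged.\<close>

definition gram :: "'n set \<Rightarrow> ('n \<Rightarrow> 'e::real_inner) \<Rightarrow> real ^ 'n ^ 'n" where
  "gram J v = (\<chi> i j. if i \<in> J \<and> j \<in> J then v i \<bullet> v j else if i = j then 1 else 0)"

lemma gram_mult_vec:
  fixes J :: "'n::finite set"
  shows "(gram J v *v c) $ i = (if i \<in> J then v i \<bullet> (\<Sum>j\<in>J. c $ j *\<^sub>R v j) else c $ i)"
proof (cases "i \<in> J")
  case True
  have "(gram J v *v c) $ i = (\<Sum>j\<in>UNIV. if j \<in> J then c $ j * (v i \<bullet> v j) else 0)"
    unfolding gram_def matrix_vector_mult_def using True by (auto intro!: sum.cong)
  then show ?thesis
    using True by (simp add: inner_sum_right flip: sum.inter_filter)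
next
  case False
  have "(gram J v *v c) $ i = (\<Sum>j\<in>UNIV. (if i = j then 1 else 0) * c $ j)"
    unfolding gram_def matrix_vector_mult_def using False by simp
  also have "\<dots> = (\<Sum>j\<in>UNIV. if i = j then c $ j else 0)"
    by (intro sum.cong) auto
  finally have "(gram J v *v c) $ i = c $ i"
    by simp
  then show ?thesis using False by simp
qed

text \<open>Independence of a family, as opposed to that of its range, excludes repetitions; in this form it
  amounts to the usual condition on coefficients.\<close>

lemma independent_image_iff:
  fixes v :: "'i \<Rightarrow> 'e::euclidean_space"
  assumes "finite J"
  shows "inj_on v J \<and> independent (v ` J) \<longleftrightarrow>
    (\<forall>c. (\<Sum>i\<in>J. c i *\<^sub>R v i) = 0 \<longrightarrow> (\<forall>i\<in>J. c i = 0))" (is "?L \<longleftrightarrow> ?R")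
proof
  assume L: ?L
  show ?R
  proof (intro allI impI ballI)
    fix c i assume c: "(\<Sum>i\<in>J. c i *\<^sub>R v i) = 0" and i: "i \<in> J"
    have "(\<Sum>x\<in>v ` J. c (the_inv_into J v x) *\<^sub>R x) = 0"
      using L c by (subst sum.reindex) (auto simp: the_inv_into_f_f intro!: sum.cong)
    then have "c (the_inv_into J v (v i)) = 0"
      using L i independent_explicit[of "v ` J"] by fastforce
    then show "c i = 0" using L i by (simp add: the_inv_into_f_f)
  qed
next
  assume R: ?R
  have inj: "inj_on v J"
  proof (rule inj_onI, rule ccontr)
    fix i j assume ij: "i \<in> J" "j \<in> J" "v i = v j" "i \<noteq> j"
    define c where "c k = (if k = i then 1 else if k = j then -1 else (0::real))" for k
    have "(\<Sum>k\<in>J. c k *\<^sub>R v k) = (\<Sum>k\<in>{i, j}. c k *\<^sub>R v k)"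
      using assms ij by (intro sum.mono_neutral_right) (auto simp: c_def)
    also have "\<dots> = 0" using ij by (simp add: c_def)
    finally show False using R ij by (force simp: c_def)
  qed
  moreover have "independent (v ` J)"
    unfolding independent_explicit using assms R
    by (auto simp: sum.reindex[OF inj])
  ultimately show ?L ..
qed

text \<open>A coefficient vector in the kernel of the Gram matrix gives a linear combination
  orthogonal to each of its own summands, hence to itself, hence zero.\<close>

lemma det_gram_nonzero_iff:
  fixes J :: "'n::finite set" and v :: "'n \<Rightarrow> 'e::euclidean_space"
  shows "det (gram J v) \<noteq> 0 \<longleftrightarrow> inj_on v J \<and> independent (v ` J)"
proof -
  have "det (gram J v) \<noteq> 0 \<longleftrightarrow> (\<forall>c. gram J v *v c = 0 \<longrightarrow> c = 0)"
    by (simp add: invertible_left_inverse matrix_left_invertible_ker flip: invertible_det_nz)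
  also have "\<dots> \<longleftrightarrow> (\<forall>c. (\<Sum>i\<in>J. c i *\<^sub>R v i) = 0 \<longrightarrow> (\<forall>i\<in>J. c i = 0))"
  proof (intro iffI allI impI ballI)
    fix c i assume ker: "\<forall>c. gram J v *v c = 0 \<longrightarrow> c = 0"
      and c: "(\<Sum>i\<in>J. c i *\<^sub>R v i) = 0" and i: "i \<in> J"
    define c' where "c' = (\<chi> i. if i \<in> J then c i else 0)"
    have "(\<Sum>i\<in>J. c' $ i *\<^sub>R v i) = 0"
      using c by (simp add: c'_def cong: sum.cong)
    then have "gram J v *v c' = 0"
      by (simp add: vec_eq_iff gram_mult_vec c'_def)
    then have "c' = 0" using ker by blast
    then have "c' $ i = 0" by simp
    then show "c i = 0" using i by (simp add: c'_def)
  next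
    fix c assume R: "\<forall>c. (\<Sum>i\<in>J. c i *\<^sub>R v i) = 0 \<longrightarrow> (\<forall>i\<in>J. c i = 0)"
      and c: "gram J v *v c = 0"
    define s where "s = (\<Sum>j\<in>J. c $ j *\<^sub>R v j)"
    have *: "(if i \<in> J then v i \<bullet> s else c $ i) = 0" for i
      using gram_mult_vec[of J v c i] unfolding c s_def zero_index by (rule sym)
    have "s \<bullet> s = (\<Sum>j\<in>J. c $ j * (v j \<bullet> s))"
      by (subst s_def) (simp add: inner_sum_left)
    also have "\<dots> = 0"
      using * by (intro sum.neutral) (metis mult_zero_right)
    finally have "\<forall>i\<in>J. c $ i = 0"
      using R unfolding s_def by simp
    with * show "c = 0"
      by (metis vec_eq_iff zero_index)
  qed
  finally show ?thesis using independent_image_iff[of J v] by simp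
qed

section \<open>Generic vectors in a family of subspaces\<close>

text \<open>Here \<open>f\<close> is the Gram determinant of a maximal set \<open>J\<close> of indices for which
  \<open>L i (w $ i)\<close>, \<open>i \<in> J\<close>, can be independent. The first alternative arises from an
  index \<open>k\<close> outside \<open>J\<close>: maximality puts all of \<open>range (L k)\<close> into the span of the vectors with
  index in \<open>J\<close>. The second one is the case that \<open>J\<close> contains every index.\<close>

lemma generic_annihilator:
  fixes L :: "'p::finite \<Rightarrow> 'v::euclidean_space \<Rightarrow> 'e::euclidean_space"
  assumes lin: "\<And>i. linear (L i)"
  obtains f :: "'v ^ 'p \<Rightarrow> real"
  where "real_polynomial_function f" and "\<exists>w. f w \<noteq> 0"
    and "\<And>w z. f w \<noteq> 0 \<Longrightarrow> (\<And>i. L i (w $ i) \<bullet> z = 0) \<Longrightarrow>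
           (\<exists>k. \<forall>v. L k v \<bullet> z = 0) \<or> inj (\<lambda>i. L i (w $ i)) \<and> independent (range (\<lambda>i. L i (w $ i)))"
proof -
  define ind where "ind J w \<longleftrightarrow> inj_on (\<lambda>i. L i (w $ i)) J \<and> independent ((\<lambda>i. L i (w $ i)) ` J)"
    for J and w :: "'v ^ 'p"
  define A where "A = {J. \<exists>w. ind J w}"
  have "{} \<in> A"
    by (simp add: A_def ind_def independent_empty)
  then obtain J where J: "J \<in> A" and Jmax: "\<And>K. K \<in> A \<Longrightarrow> J \<subseteq> K \<Longrightarrow> K = J"
    using finite_has_maximal[of A] finite[of A] by blast
  define f where "f w = det (gram J (\<lambda>i. L i (w $ i)))" for w :: "'v ^ 'p"
  have f: "f w \<noteq> 0 \<longleftrightarrow> ind J w" for w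
    unfolding f_def ind_def by (rule det_gram_nonzero_iff)
  show ?thesis
  proof
    have bl: "bounded_linear (\<lambda>w::'v ^ 'p. L i (w $ i) \<bullet> b)" for i b
    proof -
      have "bounded_linear (L i)" using lin linear_conv_bounded_linear by blast
      then show ?thesis
        by (intro bounded_linear_inner_left_comp bounded_linear_compose[OF _ bounded_linear_vec_nth])
    qed
    have "real_polynomial_function (\<lambda>w::'v ^ 'p. L i (w $ i) \<bullet> L j (w $ j))" for i j
      by (subst euclidean_inner, intro real_polynomial_function_sum real_polynomial_function.intros(4)
          real_polynomial_function.intros(1) bl finite_Basis)
    then have "real_polynomial_function (\<lambda>w. gram J (\<lambda>i. L i (w $ i)) $ i $ j)" for i j
      unfolding gram_def
      by (cases "i \<in> J"; cases "j \<in> J"; cases "i = j") (simp_all add: real_polynomial_function.intros(2))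
    then show "real_polynomial_function f"
      unfolding f_def det_def
      by (intro real_polynomial_function_sum real_polynomial_function.intros(2,4)
          real_polynomial_function_prod finite finite_permutations)
    show "\<exists>w. f w \<noteq> 0"
      using J f A_def by simp
    fix w z assume w: "f w \<noteq> 0" and z: "\<And>i. L i (w $ i) \<bullet> z = 0"
    let ?B = "(\<lambda>i. L i (w $ i)) ` J"
    show "(\<exists>k. \<forall>v. L k v \<bullet> z = 0) \<or> inj (\<lambda>i. L i (w $ i)) \<and> independent (range (\<lambda>i. L i (w $ i)))"
    proof (cases "J = UNIV")
      case True
      then show ?thesis using w f ind_def by simp
    next
      case False
      then obtain k where k: "k \<notin> J" by blast
      \<comment> \<open>Otherwise replacing the \<open>k\<close>-th entry of \<open>w\<close> by \<open>v\<close> would show that \<open>insert k J\<close> can be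
        independent, against maximality.\<close>
      have "L k v \<in> span ?B" for v
      proof (rule ccontr)
        assume v: "L k v \<notin> span ?B"
        define w' where "w' = (\<chi> i. if i = k then v else w $ i)"
        have img: "(\<lambda>i. L i (w' $ i)) ` J = ?B"
          using k by (intro image_cong) (auto simp: w'_def)
        have "inj_on (\<lambda>i. L i (w' $ i)) J = inj_on (\<lambda>i. L i (w $ i)) J"
          using k by (intro inj_on_cong) (auto simp: w'_def)
        then have "ind J w'"
          using w img f unfolding ind_def by simp
        moreover have "L k (w' $ k) \<notin> span ((\<lambda>i. L i (w' $ i)) ` J)"
          using v img by (simp add: w'_def)
        ultimately have "ind (insert k J) w'"
          using span_base[of "L k (w' $ k)" "(\<lambda>i. L i (w' $ i)) ` J"] k
          unfolding ind_def by (auto simp del: image_iff simp: independent_insert)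
        then have "insert k J = J"
          using Jmax by (auto simp: A_def)
        then show False using k by blast
      qed
      moreover have "x \<bullet> z = 0" if "x \<in> span ?B" for x
        using that by (rule span_induct[OF _ subspace_hyperplane2]) (use z in auto)
      ultimately show ?thesis by blast
    qed
  qed
qed

section \<open>Separation of orbits\<close>

lemma coorbit_eq_inner:
  fixes G :: "('g, 'm) monoid_scheme"
  assumes "finite (carrier G)" "j \<in> {1..order G}"
  shows "\<exists>g\<in>carrier G. coorbit G U w j x = U g w \<bullet> x"
proof -
  let ?M = "{#U g w \<bullet> x. g \<in># mset_set (carrier G)#}"
  have "coorbit G U w j x \<in> set (rev (sorted_list_of_multiset ?M))"
    unfolding coorbit_def using assms
    by (intro nth_mem) (auto simp: order_def simp flip: size_mset)
  then show ?thesis using assms by auto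
qed

text \<open>Moving the isometries to the other side turns the hypothesis into
  \<open>U (inv g) x = U (inv h) y\<close>, a common point of the two orbits.\<close>

lemma orthogonal_to_orbit_pair:
  fixes U :: "'g \<Rightarrow> 'v::euclidean_space \<Rightarrow> 'v"
  assumes act: "group_action G UNIV U"
    and iso: "\<And>g. g \<in> carrier G \<Longrightarrow> orthogonal_transformation (U g)"
    and g: "g \<in> carrier G" and h: "h \<in> carrier G"
    and eq: "\<And>v. U g v \<bullet> x = U h v \<bullet> y"
  shows "orbit G U x = orbit G U y"
proof -
  interpret group_action G UNIV U by fact
  interpret group G using group_hom by (simp add: group_hom_def)
  have adj: "U k v \<bullet> z = v \<bullet> U (inv\<^bsub>G\<^esub> k) z" if "k \<in> carrier G" for k v z
  proof -
    have "U (inv\<^bsub>G\<^esub> k) (U k v) = v"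
      using that by (rule orbit_sym_aux) auto
    moreover have "U (inv\<^bsub>G\<^esub> k) (U k v) \<bullet> U (inv\<^bsub>G\<^esub> k) z = U k v \<bullet> z"
      using iso[of "inv\<^bsub>G\<^esub> k"] that by (simp add: orthogonal_transformation_def)
    ultimately show ?thesis by simp
  qed
  have orb: "U k z \<in> orbit G U z" if "k \<in> carrier G" for k z
    unfolding orbit_def using that by blast
  have "U (inv\<^bsub>G\<^esub> g) x = U (inv\<^bsub>G\<^esub> h) y"
    using eq adj[OF g] adj[OF h] by (intro vector_eq_ldot[THEN iffD1]) auto
  then have "U (inv\<^bsub>G\<^esub> g) x \<in> orbit G U x \<inter> orbit G U y"
    using orb[of "inv\<^bsub>G\<^esub> g" x] orb[of "inv\<^bsub>G\<^esub> h" y] g h by simp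
  moreover have "orbit G U a \<subseteq> orbit G U b" if c: "c \<in> orbit G U a" "c \<in> orbit G U b" for a b c
    using orbit_sym[of a c] orbit_trans c by blast
  ultimately show ?thesis by blast
qed

text \<open>If \<open>(x, y)\<close> were not in the diagonal copy of \<open>V\<close>, adding it would raise the dimension of that
  copy to \<open>dim V + 1\<close>, too large for the orthogonal complement of \<open>B\<close>.\<close>

lemma diagonal_of_orthogonal_independent:
  fixes B :: "('v::euclidean_space \<times> 'v) set"
  assumes B: "independent B" and V: "subspace V"
    and card: "int (card B) \<ge> 2 * int DIM('v) - int (dim V)"
    and diag: "\<And>b v. b \<in> B \<Longrightarrow> v \<in> V \<Longrightarrow> b \<bullet> (v, v) = 0"
    and z: "\<And>b. b \<in> B \<Longrightarrow> b \<bullet> (x, y) = 0"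
  shows "x = y"
proof -
  let ?D = "(\<lambda>v. (v, v)) ` V"
  have lin: "linear (\<lambda>v::'v. (v, v))"
    by (intro linearI) auto
  have D: "dim ?D = dim V"
    by (rule dim_image_eq[OF lin]) (auto simp: inj_on_def)
  have "dim (B \<union> insert (x, y) ?D) = dim B + dim (insert (x, y) ?D)"
    by (rule dim_orthogonal_sum) (use diag z in auto)
  then have "dim B + dim (insert (x, y) ?D) \<le> DIM('v \<times> 'v)"
    by (metis dim_subset_UNIV)
  then have "dim (insert (x, y) ?D) \<le> dim ?D"
    using card dim_eq_card_independent[OF B] D by simp
  then have "(x, y) \<in> span ?D"
    by (auto simp: dim_insert split: if_splits)
  then have "(x, y) \<in> ?D"
    using linear_subspace_image[OF lin V] by (simp add: span_eq_iff[THEN iffD2])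
  then show ?thesis by auto
qed

theorem theorem2p4:
  fixes G :: "('g, 'm) monoid_scheme"
    and U :: "'g \<Rightarrow> 'v::euclidean_space \<Rightarrow> 'v"
  assumes "DIM('v) \<ge> 2"
    and "finite (carrier G)"
    and "group_action G UNIV U"
    and "\<And>g. g \<in> carrier G \<Longrightarrow> orthogonal_transformation (U g)"
    and "int CARD('p::finite) \<ge> 2 * int DIM('v) - int (dim (fixed_subspace G U))"
  shows "zariski_generic (\<lambda>w :: 'v ^ 'p.
           \<forall>S \<subseteq> {1..order G} \<times> UNIV.
             (\<forall>i. {k \<in> {1..order G}. (k, i) \<in> S} \<noteq> {}) \<longrightarrow>
             inj_on (coorbit_map_quot G U w S) (orbits G UNIV U))"
proof -
  note act = assms(3) and iso = assms(4)
  interpret group_action G UNIV U by (fact act)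
  let ?V = "fixed_subspace G U"
  define L where "L gh v = (U (fst gh) v, - U (snd gh) v)" for gh v
  \<comment> \<open>The extensional function space is used only to have a finite set of all choices.\<close>
  define C where "C = (UNIV :: 'p set) \<rightarrow>\<^sub>E carrier G \<times> carrier G"
  have C: "c i \<in> carrier G \<times> carrier G" if "c \<in> C" for c i
    using that unfolding C_def by blast
  have linU: "linear (U g)" if "g \<in> carrier G" for g
    using iso[OF that] by (rule orthogonal_transformation_linear)
  have linL: "linear (L gh)" if "gh \<in> carrier G \<times> carrier G" for gh
    using that linU[of "fst gh"] linU[of "snd gh"]
    by (intro linearI) (auto simp: L_def linear_add linear_cmul)
  have V: "subspace ?V"
    unfolding fixed_subspace_def invariants_def subspace_def
    using linU by (auto simp: linear_0 linear_add linear_cmul)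
  have "\<forall>c\<in>C. \<exists>f. real_polynomial_function f \<and> (\<exists>w. f w \<noteq> 0) \<and>
      (\<forall>w x y. f w \<noteq> 0 \<longrightarrow> (\<forall>i. L (c i) (w $ i) \<bullet> (x, y) = 0) \<longrightarrow> orbit G U x = orbit G U y)"
  proof
    fix c assume c: "c \<in> C"
    obtain f :: "'v ^ 'p \<Rightarrow> real" where f: "real_polynomial_function f" "\<exists>w. f w \<noteq> 0"
      and ann: "\<And>w z. f w \<noteq> 0 \<Longrightarrow> (\<And>i. L (c i) (w $ i) \<bullet> z = 0) \<Longrightarrow>
        (\<exists>k. \<forall>v. L (c k) v \<bullet> z = 0) \<or>
        inj (\<lambda>i. L (c i) (w $ i)) \<and> independent (range (\<lambda>i. L (c i) (w $ i)))"
      using generic_annihilator[of "\<lambda>i. L (c i)", OF linL[OF C[OF c]]] by blast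
    have "orbit G U x = orbit G U y"
      if w: "f w \<noteq> 0" and z: "\<And>i. L (c i) (w $ i) \<bullet> (x, y) = 0" for w x y
      using ann[OF w z]
    proof (elim disjE exE conjE)
      fix k assume "\<forall>v. L (c k) v \<bullet> (x, y) = 0"
      then have "U (fst (c k)) v \<bullet> x = U (snd (c k)) v \<bullet> y" for v
        by (simp add: L_def)
      then show ?thesis
        using C[OF c, of k] by (intro orthogonal_to_orbit_pair[OF act iso]) auto
    next
      assume inj: "inj (\<lambda>i. L (c i) (w $ i))"
        and ind: "independent (range (\<lambda>i. L (c i) (w $ i)))"
      have "x = y"
      proof (rule diagonal_of_orthogonal_independent[OF ind V])
        show "int (card (range (\<lambda>i. L (c i) (w $ i)))) \<ge> 2 * int DIM('v) - int (dim ?V)"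
          using assms(5) by (simp add: card_image[OF inj])
        fix b v assume "b \<in> range (\<lambda>i. L (c i) (w $ i))" and v: "v \<in> ?V"
        then obtain i where b: "b = L (c i) (w $ i)" by blast
        \<comment> \<open>A fixed vector does not distinguish \<open>u\<close> from \<open>U g u\<close>, so both halves of \<open>b\<close> pair with \<open>v\<close>
          to the same number up to sign.\<close>
        have "U g u \<bullet> v = u \<bullet> v" if g: "g \<in> carrier G" for g u
        proof -
          have "U g v = v" using v g by (auto simp: fixed_subspace_def invariants_def)
          then show ?thesis using iso[OF g] by (metis orthogonal_transformation_def)
        qed
        then show "b \<bullet> (v, v) = 0"
          using C[OF c, of i] by (auto simp: b L_def)
      qed (use z in auto)
      then show ?thesis by simp
    qed
    with f show "\<exists>f. real_polynomial_function f \<and> (\<exists>w. f w \<noteq> 0) \<and>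
      (\<forall>w x y. f w \<noteq> 0 \<longrightarrow> (\<forall>i. L (c i) (w $ i) \<bullet> (x, y) = 0) \<longrightarrow> orbit G U x = orbit G U y)"
      by blast
  qed
  from bchoice[OF this] obtain f where f: "\<And>c. c \<in> C \<Longrightarrow> real_polynomial_function (f c)"
      "\<And>c. c \<in> C \<Longrightarrow> \<exists>w. f c w \<noteq> 0"
    and sep: "\<And>c w x y. c \<in> C \<Longrightarrow> f c w \<noteq> 0 \<Longrightarrow> (\<forall>i. L (c i) (w $ i) \<bullet> (x, y) = 0) \<Longrightarrow>
      orbit G U x = orbit G U y"
    by blast
  have finC: "finite C"
    unfolding C_def using assms(2) by (intro finite_PiE) auto
  obtain a where a: "(\<Prod>c\<in>C. f c a) \<noteq> 0"
    using real_polynomial_function_prod_nonzero[of C f] finC f by blast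
  show ?thesis
  proof (rule zariski_generic_nonvanishing[of "\<lambda>w. \<Prod>c\<in>C. f c w"])
    show "real_polynomial_function (\<lambda>w. \<Prod>c\<in>C. f c w)"
      using finC f by auto
    show "(\<Prod>c\<in>C. f c a) \<noteq> 0" by (fact a)
    fix w :: "'v ^ 'p" assume w: "(\<Prod>c\<in>C. f c w) \<noteq> 0"
    show "\<forall>S \<subseteq> {1..order G} \<times> UNIV. (\<forall>i. {k \<in> {1..order G}. (k, i) \<in> S} \<noteq> {}) \<longrightarrow>
        inj_on (coorbit_map_quot G U w S) (orbits G UNIV U)"
    proof (intro allI impI inj_onI)
      fix S X Y
      assume S: "\<forall>i. {k \<in> {1..order G}. (k, i) \<in> S} \<noteq> {}"
        and XY: "X \<in> orbits G UNIV U" "Y \<in> orbits G UNIV U"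
          "coorbit_map_quot G U w S X = coorbit_map_quot G U w S Y"
      obtain x y where X: "X = orbit G U x" and Y: "Y = orbit G U y"
        using XY unfolding orbits_def by blast
      have map: "coorbit_map G U w S x = coorbit_map G U w S y"
        using XY(3) coorbit_map_quot_orbit[OF act iso] unfolding X Y by metis
      have "\<exists>gh\<in>carrier G \<times> carrier G. L gh (w $ i) \<bullet> (x, y) = 0" for i
      proof -
        obtain j where j: "j \<in> {1..order G}" "(j, i) \<in> S"
          using S by blast
        have "coorbit G U (w $ i) j x = coorbit G U (w $ i) j y"
          using fun_cong[OF map, of "(j, i)"] j by (simp add: coorbit_map_def)
        moreover obtain g where "g \<in> carrier G" "coorbit G U (w $ i) j x = U g (w $ i) \<bullet> x"
          using coorbit_eq_inner[OF assms(2) j(1)] by blast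
        moreover obtain h where "h \<in> carrier G" "coorbit G U (w $ i) j y = U h (w $ i) \<bullet> y"
          using coorbit_eq_inner[OF assms(2) j(1)] by blast
        ultimately show ?thesis
          by (intro bexI[of _ "(g, h)"]) (auto simp: L_def)
      qed
      then obtain c where c: "\<And>i. c i \<in> carrier G \<times> carrier G"
          "\<And>i. L (c i) (w $ i) \<bullet> (x, y) = 0"
        by metis
      then have cC: "c \<in> C" unfolding C_def by auto
      moreover have "f c w \<noteq> 0" using w cC finC by auto
      ultimately show "X = Y" using sep c(2) X Y by blast
    qed
  qed
qed

end
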